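(* (i) For each prime $p\in\{2,3,5,11,17,41\}$ the polynomial $E_p(x)=x^2+x+p$ assumes prime values $p+x(x+1)$ for $x=0,1,\ldots,p-2$, forming a regular $(p-1)$-plet at distances $E_p(x+1)-E_p(x)=2(x+1)$. (ii) For each prime $p\in\{3,5,11,29\}$ the polynomial $f_p(x)=2x^2+p$ assumes prime values for $x=0,1,\ldots,p-1$, forming a regular $p$-plet at distances $f_p(x+1)-f_p(x)=2(2x+1)$. (iii) For each prime $p\in\{5,13,37\}$ (all $\equiv 1\pmod 4$) the polynomial $F_p(x)=2x^2+2x+\frac12(p+1)$ assumes prime values for $x=0,1,\ldots,(p-3)/2$, forming a regular $(p-1)/2$-plet at distances $F_p(x+1)-F_p(x)=4(x+1)$. (iv) For each pair of primes $(p,q)$ with $p<q$, $pq\equiv 3\pmod 4$, in the list $(3,5),(3,17),(3,41),(3,89),(5,7),(5,23),(5,47),(7,13),(7,61),(11,17),(13,31)$, the polynomial $G_p(x)=px^2+px+\frac14(p+q)$ assumes prime values for $x=0,1,\ldots,\frac14(p+q)-2$, forming a regular multiplet at distances $G_p(x+1)-G_p(x)=2p(x+1)$, independent of $q$. (v) For each $d\in\{37,53,77,101,173,197,293,437,677\}$ (square-free, $d\equiv 1\pmod 4$) the polynomial $g_d(x)=-x^2+x+\frac14(d-1)$ assumes prime values for all integers $x$ with $2\le x<\frac12\sqrt{d-1}$, forming a regular multiplet with differences $g_d(x+1)-g_d(x)=-2x$. (vi) The polynomial $x^2+x+p$ assumes prime values (forming a regular multiplet) in the following cases: \begin{itemize}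 \item quintets, $x=0,\ldots,4$: $p=11, 17, 41, 347, 641, 1427, 4001, 4637, 4931, 19421, 22271, 23741, 26711, 27941, 28277, 31247, 32057, 33617, 113147$; \item sextets, $x=0,\ldots,5$: $p=11, 17, 41, 1277, 1607, 3527, 28277, 31247, 33617, 55661, 113147, 128981, 548831, 566537$; \item septets, $x=0,\ldots,6$: $p=11,17,41,1277,28277,113147,128981$; \item octets, $x=0,\ldots,7$: $p=11,17,41,128981$; \item nonets, $x=0,\ldots,8$: $p=11,17,41$; \item decuplets, $x=0,\ldots,9$: $p=11,17,41$. \end{itemize}
   Context: A regular $N$-plet (regular multiplet) generated by a polynomial $P$ is a list of $N$ values of $P$ at consecutive integer arguments all of which are prime; its distances are the differences $P(x+1)-P(x)$ of successive members, which for a quadratic polynomial are given by a linear function of $x$. The members need not be consecutive primes. *)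

theory Defs
  imports
    Complex_Main
    "HOL-Computational_Algebra.Computational_Algebra"
    "HOL-Number_Theory.Cong"
begin

text \<open>\<^term>\<open>[a..b]\<close> on integers is the increasing list of all integers from \<open>a\<close> to \<open>b\<close>, so the
  members are values at consecutive integer arguments.\<close>

definition regular_multiplet :: "int poly \<Rightarrow> int list \<Rightarrow> bool" where
  "regular_multiplet P vs \<longleftrightarrow>
     vs \<noteq> [] \<and> (\<exists>a b. vs = map (poly P) [a..b]) \<and> (\<forall>v\<in>set vs. prime v)"

definition regular_plet :: "nat \<Rightarrow> int poly \<Rightarrow> int list \<Rightarrow> bool" where
  "regular_plet N P vs \<longleftrightarrow> regular_multiplet P vs \<and> length vs = N"

text \<open>Coefficients are listed from the constant term upwards. The integer divisions are exact
  in all uses: \<open>p \<equiv> 1\<close> mod 4 gives \<open>2 dvd p + 1\<close>; \<open>p * q \<equiv> 3\<close> mod 4 gives \<open>4 dvd p + q\<close>;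
  \<open>d \<equiv> 1\<close> mod 4 gives \<open>4 dvd d - 1\<close>.\<close>

definition E_poly :: "int \<Rightarrow> int poly" where
  "E_poly p = [:p, 1, 1:]"

definition f_poly :: "int \<Rightarrow> int poly" where
  "f_poly p = [:p, 0, 2:]"

definition F_poly :: "int \<Rightarrow> int poly" where
  "F_poly p = [:(p + 1) div 2, 2, 2:]"

definition G_poly :: "int \<Rightarrow> int \<Rightarrow> int poly" where
  "G_poly p q = [:(p + q) div 4, p, p:]"

definition g_poly :: "int \<Rightarrow> int poly" where
  "g_poly d = [:(d - 1) div 4, 1, -1:]"

end

theory Submission
  imports Defs
begin

text \<open>Every clause involves finitely many explicit parameters and arguments, so the theorem is
  a finite verification. By \<open>prime_int_iff_trial_division\<close>, primality becomes a search
  for odd divisors up to the square root, and the lemmas listing prime values are then decided by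
  \<open>code_simp\<close>, which runs this search on numerals by rewriting.

  Three things are not bare primality checks. The differences are polynomial identities in
  \<open>x\<close> (\<open>poly_differences\<close>). The range in (v) is cut out by a real square
  root, and \<open>less_half_sqrt_interval\<close> turns it into an explicit integer interval.
  Square-freeness in (v) follows from prime factorizations.\<close>

section \<open>Primality by trial division\<close>

function no_odd_divisor_from :: "int \<Rightarrow> int \<Rightarrow> bool" where
  "no_odd_divisor_from d n \<longleftrightarrow>
    (if n < d * d then True else if n mod d = 0 then False else no_odd_divisor_from (d + 2) n)"
  by auto

termination
proof (relation "measure (\<lambda>(d, n). nat (n + 1 - d))")
  fix d n :: int
  assume "\<not> n < d * d"
  \<comment> \<open>This holds for every integer, so a recursive call occurs only when
    \<open>d \<le> n\<close>; there \<open>n + 1 - d\<close> is positive and strictly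
    decreases.\<close>
  moreover have "d \<le> d * d"
    using mult_right_mono[of 1 d d] zero_le_square[of d] by (cases "d \<le> 0") linarith+
  ultimately show "((d + 2, n), (d, n)) \<in> measure (\<lambda>(d, n). nat (n + 1 - d))"
    by auto
qed simp

text \<open>The equation has no guard outside its right-hand side, so as a simp rule it could unfold
  forever on symbolic arguments.\<close>

declare no_odd_divisor_from.simps [simp del]

text \<open>Stopping once \<open>d * d\<close> exceeds \<open>n\<close> loses nothing, since for
  positive \<open>d\<close> all later candidates have squares at least as large. Oddness of
  \<open>d\<close> makes steps of 2 reach every odd \<open>k\<close> from \<open>d\<close>
  on.\<close>

lemma no_odd_divisor_from_iff:
  assumes "odd d" "0 < d"
  shows "no_odd_divisor_from d n \<longleftrightarrow> (\<forall>k. odd k \<and> d \<le> k \<and> k * k \<le> n \<longrightarrow> \<not> k dvd n)"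
  using assms
proof (induction d n rule: no_odd_divisor_from.induct)
  case (1 d n)
  show ?case
  proof (cases "n < d * d")
    case True
    have "n < k * k" if "d \<le> k" for k
      using mult_mono[OF that that] 1 True that by linarith
    with True show ?thesis
      by (force simp: no_odd_divisor_from.simps[of d n])
  next
    case False
    have "d \<le> k \<longleftrightarrow> k = d \<or> d + 2 \<le> k" if "odd k" for k
      using that \<open>odd d\<close> by presburger
    with False 1 show ?thesis
      by (auto simp: no_odd_divisor_from.simps[of d n] mod_eq_0_iff_dvd)
  qed
qed

text \<open>In a proper factorization of \<open>n\<close> the smaller factor has square at most
  \<open>n\<close>, and all divisors of an odd number are odd. The right-hand side is
  executable.\<close>

lemma prime_int_iff_trial_division:
  fixes n :: int
  shows "prime n \<longleftrightarrow> n = 2 \<or> 1 < n \<and> odd n \<and> no_odd_divisor_from 3 n"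
proof
  assume "prime n"
  have "\<not> k dvd n" if "3 \<le> k" "k * k \<le> n" for k
  proof (rule prime_int_not_dvd[OF \<open>prime n\<close>])
    have "k * 1 < k * k"
      using that by (intro mult_strict_left_mono) auto
    with that show "k < n" by linarith
  qed (use that in simp)
  with \<open>prime n\<close> show "n = 2 \<or> 1 < n \<and> odd n \<and> no_odd_divisor_from 3 n"
    using prime_odd_int[of n] prime_gt_1_int[of n]
    by (auto simp: no_odd_divisor_from_iff)
next
  assume n: "n = 2 \<or> 1 < n \<and> odd n \<and> no_odd_divisor_from 3 n"
  show "prime n"
  proof (cases "n = 2")
    case False
    with n have n: "1 < n" "odd n" "no_odd_divisor_from 3 n" by auto
    have no_small: "\<not> k dvd n" if "1 < k" "k * k \<le> n" for k
    proof
      assume "k dvd n"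
      with \<open>odd n\<close> have "odd k" by auto
      moreover from this \<open>1 < k\<close> have "3 \<le> k" by presburger
      ultimately show False
        using n that \<open>k dvd n\<close> by (auto simp: no_odd_divisor_from_iff)
    qed
    have "\<not> k dvd n" if k: "2 \<le> k" "k < n" for k
    proof
      assume "k dvd n"
      then obtain j where j: "n = k * j" by blast
      have "1 < j"
        using j k n(1) by (smt (verit) mult_less_0_iff mult_cancel_left1 mult_eq_0_iff zero_less_mult_iff)
      show False
      \<comment> \<open>The smaller of the cofactors \<open>k\<close> and \<open>j\<close>
        contradicts \<open>no_small\<close>.\<close>
      proof (cases "k \<le> j")
        case True
        then have "k * k \<le> n" using j k by (simp add: mult_left_mono)
        then show False using no_small[of k] k \<open>k dvd n\<close> by simp
      next
        case False
        then have "j * j \<le> n" using j \<open>1 < j\<close> by (simp add: mult_right_mono)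
        then show False using no_small[of j] \<open>1 < j\<close> j by simp
      qed
    qed
    with n show "prime n" by (auto simp: prime_int_iff')
  qed simp
qed

section \<open>Multiplets over integer intervals and the square-root range\<close>

lemma regular_multiplet_map_upto:
  "regular_multiplet P (map (poly P) [a..b]) \<longleftrightarrow>
    a \<le> b \<and> (\<forall>x\<in>{a..b}. prime (poly P x))"
  by (auto simp: regular_multiplet_def)

lemma regular_plet_map_upto:
  "regular_plet N P (map (poly P) [a..b]) \<longleftrightarrow>
    a \<le> b \<and> (\<forall>x\<in>{a..b}. prime (poly P x)) \<and> N = nat (b - a + 1)"
  by (auto simp: regular_plet_def regular_multiplet_map_upto)

lemma sorted_list_of_set_atLeastAtMost_int:
  "sorted_list_of_set {a..b::int} = [a..b]"
  by (simp add: sorted_list_of_set.idem_if_sorted_distinct flip: set_upto)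

text \<open>For nonnegative \<open>x\<close>, twice \<open>x\<close> is the square root of
  \<open>4 * x\<^sup>2\<close>, and \<open>sqrt\<close> is strictly increasing.\<close>

lemma less_half_sqrt_iff:
  fixes x n :: int
  assumes "0 \<le> x"
  shows "real_of_int x < 1 / 2 * sqrt (real_of_int n) \<longleftrightarrow> 4 * x\<^sup>2 < n"
proof -
  have "sqrt (real_of_int (4 * x\<^sup>2)) = 2 * real_of_int x"
    using assms by (simp add: real_sqrt_mult)
  then have "real_of_int x < 1 / 2 * sqrt (real_of_int n) \<longleftrightarrow>
      sqrt (real_of_int (4 * x\<^sup>2)) < sqrt (real_of_int n)"
    by linarith
  then show ?thesis
    by (simp only: real_sqrt_less_iff of_int_less_iff)
qed

text \<open>The hypotheses say that \<open>m\<close> is the last integer strictly below the bound.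
  Equality is allowed in the third one because the bound is strict: for \<open>d = 37\<close> it is
  exactly 3, so \<open>m = 2\<close>.\<close>

lemma less_half_sqrt_interval:
  fixes n m :: int
  assumes "0 \<le> m" "4 * m\<^sup>2 < n" "n \<le> 4 * (m + 1)\<^sup>2"
  shows "{x. 2 \<le> x \<and> real_of_int x < 1 / 2 * sqrt (real_of_int n)} = {2..m}"
proof -
  have "4 * x\<^sup>2 < n \<longleftrightarrow> x \<le> m" if "2 \<le> x" for x
  proof (cases "x \<le> m")
    case True
    then have "x\<^sup>2 \<le> m\<^sup>2" using that by (intro power_mono) auto
    with True assms show ?thesis by linarith
  next
    case False
    then have "(m + 1)\<^sup>2 \<le> x\<^sup>2" using assms(1) by (intro power_mono) auto
    with False assms show ?thesis by linarith
  qed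
  moreover have "real_of_int x < 1 / 2 * sqrt (real_of_int n) \<longleftrightarrow> 4 * x\<^sup>2 < n" if "2 \<le> x" for x
    using that by (intro less_half_sqrt_iff) simp
  ultimately show ?thesis
    unfolding set_eq_iff mem_Collect_eq atLeastAtMost_iff by blast
qed

section \<open>Computed prime values and square-freeness\<close>

lemma E_poly_prime_values:
  "\<forall>p\<in>{2, 3, 5, 11, 17, 41}. prime p \<and> (\<forall>x\<in>{0..p - 2}. prime (poly (E_poly p) x))"
  unfolding prime_int_iff_trial_division by code_simp

lemma f_poly_prime_values:
  "\<forall>p\<in>{3, 5, 11, 29}. prime p \<and> (\<forall>x\<in>{0..p - 1}. prime (poly (f_poly p) x))"
  unfolding prime_int_iff_trial_division by code_simp

lemma F_poly_prime_values:
  "\<forall>p\<in>{5, 13, 37}. prime p \<and> (\<forall>x\<in>{0..(p - 3) div 2}. prime (poly (F_poly p) x))"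
  unfolding prime_int_iff_trial_division by code_simp

lemma G_poly_prime_values:
  "\<forall>(p, q)\<in>{(3, 5), (3, 17), (3, 41), (3, 89), (5, 7), (5, 23), (5, 47),
      (7, 13), (7, 61), (11, 17), (13, 31)}.
     prime p \<and> prime q \<and> (\<forall>x\<in>{0..(p + q) div 4 - 2}. prime (poly (G_poly p q) x))"
  unfolding prime_int_iff_trial_division by code_simp

text \<open>In each pair \<open>m\<close> is the largest integer strictly below \<open>sqrt (d - 1) / 2\<close>.\<close>

lemma g_poly_prime_values:
  "\<forall>(d, m)\<in>{(37, 2), (53, 3), (77, 4), (101, 4), (173, 6), (197, 6), (293, 8),
      (437, 10), (677, 12)}.
     \<forall>x\<in>{2..m}. prime (poly (g_poly d) x)"
  unfolding prime_int_iff_trial_division by code_simp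

text \<open>All parameters are prime except 77 = 7 * 11 and 437 = 19 * 23, which are products of two
  distinct primes.\<close>

lemma squarefree_g_poly_parameters:
  "\<forall>d\<in>{37, 53, 77, 101, 173, 197, 293, 437, 677 :: int}. squarefree d"
proof -
  have primes: "\<forall>d\<in>{7, 11, 19, 23, 37, 53, 101, 173, 197, 293, 677 :: int}. prime d"
    unfolding prime_int_iff_trial_division by code_simp
  then have "squarefree (7 * 11 :: int)" "squarefree (19 * 23 :: int)"
    by (intro squarefree_mult_coprime squarefree_prime primes_coprime;
        simp del: prime_int_numeral_eq)+
  with primes show ?thesis
    by (simp add: squarefree_prime del: prime_int_numeral_eq)
qed

text \<open>Each \<open>p\<close> is listed only under the longest of its multiplets; \<open>p = 11, 17, 41\<close> are covered by
  \<open>E_poly_prime_values\<close>.\<close>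

lemma E_poly_prime_quintets:
  "\<forall>p\<in>{347, 641, 1427, 4001, 4637, 4931, 19421, 22271, 23741, 26711, 27941, 32057}. \<forall>x\<in>{0..4}. prime (poly (E_poly p) x)"
  unfolding prime_int_iff_trial_division by code_simp

lemma E_poly_prime_sextets:
  "\<forall>p\<in>{1607, 3527, 31247, 33617, 55661, 548831, 566537}. \<forall>x\<in>{0..5}. prime (poly (E_poly p) x)"
  unfolding prime_int_iff_trial_division by code_simp

lemma E_poly_prime_septets:
  "\<forall>p\<in>{1277, 28277, 113147}. \<forall>x\<in>{0..6}. prime (poly (E_poly p) x)"
  unfolding prime_int_iff_trial_division by code_simp

lemma E_poly_prime_octet:
  "\<forall>x\<in>{0..7}. prime (poly (E_poly 128981) x)"
  unfolding prime_int_iff_trial_division by code_simp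

lemmas E_poly_prime_multiplets =
  E_poly_prime_values E_poly_prime_quintets E_poly_prime_sextets E_poly_prime_septets
  E_poly_prime_octet

section \<open>Differences and assembly of the clauses\<close>

lemma poly_differences:
  "poly (f_poly p) (x + 1) - poly (f_poly p) x = 2 * (2 * x + 1)"
  "poly (F_poly p) (x + 1) - poly (F_poly p) x = 4 * (x + 1)"
  "poly (G_poly p q) (x + 1) - poly (G_poly p q) x = 2 * p * (x + 1)"
  "poly (g_poly d) (x + 1) - poly (g_poly d) x = - 2 * x"
  by (simp_all add: f_poly_def F_poly_def G_poly_def g_poly_def algebra_simps)

theorem theorem4p1:
  shows
  "\<comment> \<open>(i)\<close>
   (\<forall>p\<in>{2, 3, 5, 11, 17, 41}.
       prime p \<and>
       (\<forall>x\<in>{0..p - 2}. poly (E_poly p) x = p + x * (x + 1) \<and> prime (poly (E_poly p) x)) \<and>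
       regular_plet (nat (p - 1)) (E_poly p) (map (poly (E_poly p)) [0..p - 2]) \<and>
       (\<forall>x. poly (E_poly p) (x + 1) - poly (E_poly p) x = 2 * (x + 1))) \<and>
   \<comment> \<open>(ii)\<close>
   (\<forall>p\<in>{3, 5, 11, 29}.
       prime p \<and>
       (\<forall>x\<in>{0..p - 1}. prime (poly (f_poly p) x)) \<and>
       regular_plet (nat p) (f_poly p) (map (poly (f_poly p)) [0..p - 1]) \<and>
       (\<forall>x. poly (f_poly p) (x + 1) - poly (f_poly p) x = 2 * (2 * x + 1))) \<and>
   \<comment> \<open>(iii)\<close>
   (\<forall>p\<in>{5, 13, 37}.
       prime p \<and> [p = 1] (mod 4) \<and> 2 dvd p + 1 \<and>
       (\<forall>x\<in>{0..(p - 3) div 2}. prime (poly (F_poly p) x)) \<and>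
       regular_plet (nat ((p - 1) div 2)) (F_poly p)
         (map (poly (F_poly p)) [0..(p - 3) div 2]) \<and>
       (\<forall>x. poly (F_poly p) (x + 1) - poly (F_poly p) x = 4 * (x + 1))) \<and>
   \<comment> \<open>(iv)\<close>
   (\<forall>(p, q)\<in>{(3, 5), (3, 17), (3, 41), (3, 89), (5, 7), (5, 23), (5, 47),
                (7, 13), (7, 61), (11, 17), (13, 31)}.
       prime p \<and> prime q \<and> p < q \<and> [p * q = 3] (mod 4) \<and> 4 dvd p + q \<and>
       (\<forall>x\<in>{0..(p + q) div 4 - 2}. prime (poly (G_poly p q) x)) \<and>
       regular_multiplet (G_poly p q) (map (poly (G_poly p q)) [0..(p + q) div 4 - 2]) \<and>
       (\<forall>x. poly (G_poly p q) (x + 1) - poly (G_poly p q) x = 2 * p * (x + 1))) \<and>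
   \<comment> \<open>(v)\<close>
   (\<forall>d\<in>{37, 53, 77, 101, 173, 197, 293, 437, 677}.
       squarefree d \<and> [d = 1] (mod 4) \<and> 4 dvd d - 1 \<and>
       (\<forall>x. 2 \<le> x \<and> real_of_int x < 1 / 2 * sqrt (real_of_int (d - 1)) \<longrightarrow>
            prime (poly (g_poly d) x)) \<and>
       regular_multiplet (g_poly d)
         (map (poly (g_poly d)) (sorted_list_of_set
            {x. 2 \<le> x \<and> real_of_int x < 1 / 2 * sqrt (real_of_int (d - 1))})) \<and>
       (\<forall>x. poly (g_poly d) (x + 1) - poly (g_poly d) x = - 2 * x)) \<and>
   \<comment> \<open>(vi)\<close>
   (\<forall>p\<in>{11, 17, 41, 347, 641, 1427, 4001, 4637, 4931, 19421, 22271, 23741, 26711, 27941,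
          28277, 31247, 32057, 33617, 113147}.
       (\<forall>x\<in>{0..4}. prime (poly (E_poly p) x)) \<and>
       regular_plet 5 (E_poly p) (map (poly (E_poly p)) [0..4]))
\<and> (\<forall>p\<in>{11, 17, 41, 1277, 1607, 3527, 28277, 31247, 33617, 55661, 113147, 128981,
          548831, 566537}.
       (\<forall>x\<in>{0..5}. prime (poly (E_poly p) x)) \<and>
       regular_plet 6 (E_poly p) (map (poly (E_poly p)) [0..5]))
\<and> (\<forall>p\<in>{11, 17, 41, 1277, 28277, 113147, 128981}.
       (\<forall>x\<in>{0..6}. prime (poly (E_poly p) x)) \<and>
       regular_plet 7 (E_poly p) (map (poly (E_poly p)) [0..6]))
\<and> (\<forall>p\<in>{11, 17, 41, 128981}.
       (\<forall>x\<in>{0..7}. prime (poly (E_poly p) x)) \<and>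
       regular_plet 8 (E_poly p) (map (poly (E_poly p)) [0..7]))
\<and> (\<forall>p\<in>{11, 17, 41}.
       (\<forall>x\<in>{0..8}. prime (poly (E_poly p) x)) \<and>
       regular_plet 9 (E_poly p) (map (poly (E_poly p)) [0..8]))
\<and> (\<forall>p\<in>{11, 17, 41}.
       (\<forall>x\<in>{0..9}. prime (poly (E_poly p) x)) \<and>
       regular_plet 10 (E_poly p) (map (poly (E_poly p)) [0..9]))"
proof (intro conjI, goal_cases)
  case 1
  \<comment> \<open>This closed form also yields the difference \<open>2 * (x + 1)\<close>.\<close>
  have "poly (E_poly p) x = p + x * (x + 1)" for p x
    by (simp add: E_poly_def algebra_simps)
  with E_poly_prime_values show ?case
    \<comment> \<open>Deleting \<open>prime_int_numeral_eq\<close> keeps primality of integer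
      numerals in the form in which the computed facts supply it.\<close>
    by (simp add: regular_plet_map_upto algebra_simps del: prime_int_numeral_eq)
next
  case 2
  from f_poly_prime_values show ?case
    by (simp add: regular_plet_map_upto poly_differences del: prime_int_numeral_eq)
next
  case 3
  from F_poly_prime_values show ?case
    by (simp add: regular_plet_map_upto poly_differences cong_def del: prime_int_numeral_eq)
next
  case 4
  from G_poly_prime_values show ?case
    by (simp add: regular_multiplet_map_upto poly_differences cong_def del: prime_int_numeral_eq)
next
  case 5
  \<comment> \<open>Pairing \<open>d\<close> with the last admissible argument \<open>m\<close>
    replaces the square-root condition by the interval \<open>{2..m}\<close>.\<close>
  have part: "squarefree d \<and> [d = 1] (mod 4) \<and> 4 dvd d - 1 \<and>
      (\<forall>x. 2 \<le> x \<and> real_of_int x < 1 / 2 * sqrt (real_of_int (d - 1)) \<longrightarrow>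
        prime (poly (g_poly d) x)) \<and>
      regular_multiplet (g_poly d)
        (map (poly (g_poly d)) (sorted_list_of_set
          {x. 2 \<le> x \<and> real_of_int x < 1 / 2 * sqrt (real_of_int (d - 1))})) \<and>
      (\<forall>x. poly (g_poly d) (x + 1) - poly (g_poly d) x = - 2 * x)"
    if dm: "(d, m :: int) \<in> {(37, 2), (53, 3), (77, 4), (101, 4), (173, 6), (197, 6), (293, 8),
      (437, 10), (677, 12)}" for d m
  proof -
    have S: "{x. 2 \<le> x \<and> real_of_int x < 1 / 2 * sqrt (real_of_int (d - 1))} = {2..m}"
      using dm by (intro less_half_sqrt_interval) auto
    have "2 \<le> m" using dm by auto
    have primes: "\<forall>x\<in>{2..m}. prime (poly (g_poly d) x)"
      using bspec[OF g_poly_prime_values dm] by simp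
    have "squarefree d" "[d = 1] (mod 4)" "4 dvd d - 1"
      using dm squarefree_g_poly_parameters by (auto simp: cong_def)
    moreover have "\<forall>x. 2 \<le> x \<and> real_of_int x < 1 / 2 * sqrt (real_of_int (d - 1)) \<longrightarrow>
        prime (poly (g_poly d) x)"
      using primes unfolding S[symmetric] by blast
    ultimately show ?thesis
      unfolding S sorted_list_of_set_atLeastAtMost_int regular_multiplet_map_upto
      using \<open>2 \<le> m\<close> primes poly_differences(4) by blast
  qed
  show ?case
    by (intro ballI; elim insertE emptyE; hypsubst)
      \<comment> \<open>Backtracking search for \<open>m\<close>: only the value paired with the
        given \<open>d\<close> makes the membership goal provable.\<close>
      (rule part[of _ 2] part[of _ 3] part[of _ 4] part[of _ 6] part[of _ 8] part[of _ 10]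
        part[of _ 12], simp)+
\<comment> \<open>Each range in (vi) is an initial part of one already computed for the same
  \<open>p\<close>. For \<open>p = 11\<close> the range \<open>{0..p - 2}\<close> is just long
  enough for the decuplet.\<close>
qed (use E_poly_prime_multiplets in \<open>simp add: regular_plet_map_upto del: prime_int_numeral_eq\<close>)+

end
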